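(* Suppose $(A,B)$ and $(A,B')$ are both near-factorizations of a finite group $G$. Then $B = B'$.
   Context: Let $G$ be a finite multiplicative group with identity $e$ (not necessarily abelian). For $A, B \subseteq G$, let $AB = \{gh : g \in A, h \in B\}$. The pair $(A,B)$ is a near-factorization of $G$ if $|A| \cdot |B| = |G| - 1$ and $AB = G \setminus \{e\}$.
   Formalization: The formal statement additionally assumes that A is nonempty; this excludes only the trivial group with A empty, where the claim fails (B empty and B' = {e} both give near-factorizations), and it is automatic when |G| ≥ 2. *)

theory Defs
  imports "HOL-Algebra.Coset"
begin

text \<open>
  Intended for finite groups, where \<open>order G\<close> is positive and the subtraction on
  naturals does not truncate.  In the trivial group every pair \<open>({}, B)\<close> and \<open>(A, {})\<close>
  satisfies the definition.
\<close>

definition near_factorization ::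
  "('a, 'b) monoid_scheme \<Rightarrow> 'a set \<Rightarrow> 'a set \<Rightarrow> bool"
where
  "near_factorization G A B \<longleftrightarrow>
     A \<subseteq> carrier G \<and> B \<subseteq> carrier G \<and>
     card A * card B = order G - 1 \<and>
     A <#>\<^bsub>G\<^esub> B = carrier G - {\<one>\<^bsub>G\<^esub>}"

end

theory Submission
  imports Defs
begin

text \<open>
  Left translation by \<open>A\<close> acts on functions \<open>f : G \<rightarrow> \<int>/m\<close> through
  \<open>(A f)(x) = (\<Sum>a\<in>A. f (a\<^sup>-\<^sup>1 x))\<close>. In the group ring \<open>A B = G - e\<close>, so
  \<open>A (- B - G) = e - (|A| + 1) G\<close>, which is \<open>e\<close> for the choice \<open>m = |A| + 1\<close>.
  Hence \<open>A\<close> acts surjectively on the finite set of such functions, and therefore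
  injectively. The indicator functions of \<open>B\<close> and \<open>B'\<close> have the same image, namely
  the indicator function of \<open>G - e\<close>.
\<close>

context group
begin

text \<open>Multiplication maps \<open>A \<times> B\<close> onto
  \<open>carrier G - {\<one>}\<close>, and the two finite sets have the same size, so the map is a
  bijection and sums can be reindexed along it.\<close>

lemma near_factorization_sum:
  assumes "finite (carrier G)" and nf: "near_factorization G A B"
  shows "(\<Sum>a\<in>A. \<Sum>b\<in>B. h (a \<otimes> b)) = (\<Sum>g\<in>carrier G - {\<one>}. h g)"
proof -
  have fin: "finite (A \<times> B)"
    using assms by (auto simp: near_factorization_def intro: finite_subset)
  have img: "(\<lambda>(a, b). a \<otimes> b) ` (A \<times> B) = carrier G - {\<one>}"
  proof -
    have "(\<lambda>(a, b). a \<otimes> b) ` (A \<times> B) = A <#> B"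
      by (auto simp: set_mult_def image_iff)
    with nf show ?thesis
      by (simp add: near_factorization_def)
  qed
  have "card (carrier G - {\<one>}) = card (A \<times> B)"
    using assms by (simp add: near_factorization_def card_cartesian_product order_def)
  with fin img have "inj_on (\<lambda>(a, b). a \<otimes> b) (A \<times> B)"
    by (intro eq_card_imp_inj_on) simp_all
  then have "(\<Sum>g\<in>carrier G - {\<one>}. h g) = (\<Sum>(a, b)\<in>A \<times> B. h (a \<otimes> b))"
    by (simp add: img [symmetric] sum.reindex case_prod_unfold)
  then show ?thesis
    by (simp add: sum.cartesian_product)
qed

text \<open>Inversion followed by a translation permutes the group. Thus the whole of
  \<open>G\<close>, acting on a function, yields its total sum as a constant.\<close>

lemma sum_inv_translate:
  assumes "x \<in> carrier G"
  shows "(\<Sum>g\<in>carrier G. h (inv g \<otimes> x)) = (\<Sum>g\<in>carrier G. h g)"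
  by (rule sum.reindex_bij_witness [of _ "\<lambda>g. x \<otimes> inv g" "\<lambda>g. inv g \<otimes> x"])
    (use assms in \<open>simp_all add: inv_mult_group m_assoc [symmetric]\<close>,
      simp_all add: m_assoc)

text \<open>Residues in \<open>{0..<m}\<close> stand for \<int>/m, and \<open>restrict\<close> fixes
  the values outside the carrier, so that the functions on the group form a finite
  \<open>PiE\<close> set.\<close>

definition translate_sum :: "int \<Rightarrow> 'a set \<Rightarrow> ('a \<Rightarrow> int) \<Rightarrow> 'a \<Rightarrow> int"
  where "translate_sum m A f = (\<lambda>x\<in>carrier G. (\<Sum>a\<in>A. f (inv a \<otimes> x)) mod m)"

text \<open>The sum at \<open>x\<close> counts the pairs in \<open>A \<times> B\<close> with product
  \<open>x\<close>. The result does not mention \<open>B\<close>, so two partners of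
  \<open>A\<close> have indicators with the same image.\<close>

lemma translate_sum_indicator:
  assumes "finite (carrier G)" and nf: "near_factorization G A B"
  shows "translate_sum m A (\<lambda>x\<in>carrier G. of_bool (x \<in> B)) =
    (\<lambda>x\<in>carrier G. of_bool (x \<noteq> \<one>) mod m)"
proof -
  have sub: "A \<subseteq> carrier G" "B \<subseteq> carrier G" and "finite B"
    using assms by (auto simp: near_factorization_def intro: finite_subset)
  have "(\<Sum>a\<in>A. (\<lambda>x\<in>carrier G. of_bool (x \<in> B)) (inv a \<otimes> x)) = (of_bool (x \<noteq> \<one>) :: int)"
    if x: "x \<in> carrier G" for x
  proof -
    have "(\<lambda>x\<in>carrier G. of_bool (x \<in> B)) (inv a \<otimes> x) =
        (\<Sum>b\<in>B. if a \<otimes> b = x then 1 else (0::int))" if "a \<in> A" for a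
    proof -
      have "a \<otimes> b = x \<longleftrightarrow> b = inv a \<otimes> x" if "b \<in> B" for b
        using inv_solve_left [of b a x] that \<open>a \<in> A\<close> sub x by (auto simp: subset_iff)
      then have "(\<Sum>b\<in>B. if a \<otimes> b = x then 1 else (0::int)) =
          (\<Sum>b\<in>B. if b = inv a \<otimes> x then 1 else 0)"
        by (intro sum.cong) auto
      with that sub x \<open>finite B\<close> show ?thesis
        by (auto simp: subset_iff)
    qed
    then have "(\<Sum>a\<in>A. (\<lambda>x\<in>carrier G. of_bool (x \<in> B)) (inv a \<otimes> x)) =
        (\<Sum>a\<in>A. \<Sum>b\<in>B. if a \<otimes> b = x then 1 else (0::int))"
      by (intro sum.cong) auto
    \<comment> \<open>Here \<open>h\<close> is the indicator of the single point
      \<open>x\<close>.\<close>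
    also have "\<dots> = (\<Sum>g\<in>carrier G - {\<one>}. if g = x then 1 else 0)"
      by (rule near_factorization_sum [OF assms])
    also have "\<dots> = of_bool (x \<noteq> \<one>)"
      using assms(1) x by simp
    finally show ?thesis .
  qed
  then show ?thesis
    by (auto simp: translate_sum_def)
qed

lemma translate_sum_surj:
  fixes A B :: "'a set"
  assumes "finite (carrier G)" and nf: "near_factorization G A B"
  defines "m \<equiv> int (card A) + 1"
  defines "F \<equiv> carrier G \<rightarrow>\<^sub>E {0..<m}"
  shows "F \<subseteq> translate_sum m A ` F"
proof
  fix f assume f: "f \<in> F"
  have sub: "A \<subseteq> carrier G" "B \<subseteq> carrier G"
    using nf by (auto simp: near_factorization_def)
  have "m > 0"
    by (simp add: m_def)
  define S where "S = (\<Sum>g\<in>carrier G. f g)"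
  \<comment> \<open>The preimage of \<open>f\<close> is the group ring element - B - G applied to
    \<open>f\<close>; the part from G is the constant \<open>S\<close>.\<close>
  define u where "u = (\<lambda>x\<in>carrier G. (- (\<Sum>b\<in>B. f (inv b \<otimes> x)) - S) mod m)"
  have "u \<in> F"
    using \<open>m > 0\<close> by (auto simp: u_def F_def)
  moreover have "translate_sum m A u = f"
  proof
    fix x
    show "translate_sum m A u x = f x"
    proof (cases "x \<in> carrier G")
      case True
      have "(\<Sum>a\<in>A. \<Sum>b\<in>B. f (inv b \<otimes> (inv a \<otimes> x))) = (\<Sum>a\<in>A. \<Sum>b\<in>B. f (inv (a \<otimes> b) \<otimes> x))"
        using sub True by (intro sum.cong refl) (simp add: inv_mult_group m_assoc subset_iff)
      also have "\<dots> = (\<Sum>g\<in>carrier G - {\<one>}. f (inv g \<otimes> x))"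
        by (rule near_factorization_sum [OF assms(1) nf])
      also have "\<dots> = S - f x"
        using assms(1) True by (simp add: sum_diff1 sum_inv_translate S_def)
      finally have AB: "(\<Sum>a\<in>A. \<Sum>b\<in>B. f (inv b \<otimes> (inv a \<otimes> x))) = S - f x" .
      have "(\<Sum>a\<in>A. u (inv a \<otimes> x)) mod m =
          (\<Sum>a\<in>A. (- (\<Sum>b\<in>B. f (inv b \<otimes> (inv a \<otimes> x))) - S) mod m) mod m"
        using sub True by (intro arg_cong [of _ _ "\<lambda>i. i mod m"] sum.cong) (auto simp: u_def)
      also have "\<dots> = (\<Sum>a\<in>A. - (\<Sum>b\<in>B. f (inv b \<otimes> (inv a \<otimes> x))) - S) mod m"
        by (rule mod_sum_eq)
      \<comment> \<open>The double sum contributes \<open>f x - S\<close> and the constant term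
        \<open>- card A * S\<close>. Together they contain \<open>S\<close> exactly
        \<open>card A + 1\<close> times, which is why \<open>m\<close> has this value.\<close>
      also have "(\<Sum>a\<in>A. - (\<Sum>b\<in>B. f (inv b \<otimes> (inv a \<otimes> x))) - S) = f x + m * (- S)"
        by (simp add: sum_subtractf sum_negf AB m_def algebra_simps)
      also have "\<dots> mod m = f x"
        using PiE_mem [OF f [unfolded F_def] True] by (simp only: mod_mult_self2) simp
      finally show ?thesis
        using True by (simp add: translate_sum_def)
    next
      case False
      with f show ?thesis
        by (auto simp: translate_sum_def F_def)
    qed
  qed
  ultimately show "f \<in> translate_sum m A ` F"
    by blast
qed

end

theorem theorem1p5:
  fixes G :: "('a, 'b) monoid_scheme" and A B B' :: "'a set"
  assumes "group G"
    and "finite (carrier G)"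
    and "A \<noteq> {}"
    and "near_factorization G A B"
    and "near_factorization G A B'"
  shows "B = B'"
proof -
  interpret group G by fact
  define m where "m = int (card A) + 1"
  define F where "F = carrier G \<rightarrow>\<^sub>E {0..<m}"
  define ind where "ind C = (\<lambda>x\<in>carrier G. of_bool (x \<in> C) :: int)" for C
  have sub: "A \<subseteq> carrier G" "B \<subseteq> carrier G" "B' \<subseteq> carrier G"
    using assms by (auto simp: near_factorization_def)
  \<comment> \<open>Since \<open>A\<close> is nonempty, 0 and 1 are distinct residues, so indicators
    belong to \<open>F\<close>.\<close>
  then have "m > 1"
    using assms(2,3) by (auto simp: m_def card_gt_0_iff intro: finite_subset)
  then have ind: "ind C \<in> F" for C
    by (auto simp: ind_def F_def)
  have "finite F"
    using assms(2) by (simp add: F_def finite_PiE)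
  moreover have "F \<subseteq> translate_sum m A ` F"
    unfolding F_def m_def by (rule translate_sum_surj) fact+
  \<comment> \<open>The image of \<open>F\<close> has at most \<open>card F\<close> elements and
    contains \<open>F\<close>, so the cardinalities agree.\<close>
  ultimately have "inj_on (translate_sum m A) F"
    by (metis card_image_le card_mono eq_card_imp_inj_on finite_imageI le_antisym)
  moreover have "translate_sum m A (ind B) = translate_sum m A (ind B')"
    unfolding ind_def using assms by (simp only: translate_sum_indicator)
  ultimately have "ind B = ind B'"
    using ind by (auto dest: inj_onD)
  then have "x \<in> B \<longleftrightarrow> x \<in> B'" if "x \<in> carrier G" for x
    using that by (auto simp: ind_def restrict_def dest!: fun_cong [of _ _ x] split: if_splits)
  with sub show "B = B'"
    by blast
qed

end
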